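(* Suppose $\boldsymbol b\sim\mathcal N\bigl(\boldsymbol A(\boldsymbol x^* ),\sigma^2\mathbb I\bigr)$ and let $f:\mathbb R^m\to\mathbb R$, $\boldsymbol A:\mathbb R^n\to\mathbb R^m$, $\boldsymbol B_\gamma:\mathbb R^m\to\mathbb R^n$ and $\boldsymbol x^*\in\mathbb R^n$ be given. Define $\boldsymbol x^\gamma:=\boldsymbol B_\gamma(\boldsymbol b)$ and denote $$\boldsymbol g_\gamma:=\nabla f\circ\boldsymbol A\circ\boldsymbol B_\gamma,$$ with components $g_1,\dots,g_m$ (the dependence on $\gamma$ being suppressed). Assume that $f$, $\boldsymbol A$ and $\boldsymbol B_\gamma$ are such that $\boldsymbol g_\gamma$ is weakly differentiable, $\mathbb E f(\boldsymbol b)<\infty$, $\mathbb E D_f\bigl(\boldsymbol b,\boldsymbol A(\boldsymbol x^\gamma)\bigr)<\infty$, and that for $i\in\{1,2,\dots,m\}$, $\mathbb E_{b_i}\left|\frac{\partial g_i}{\partial b_i}(\boldsymbol b)\right|<\infty$. Then $$\mathbb E D_f\bigl(\boldsymbol A(\boldsymbol x^* ),\boldsymbol A(\boldsymbol x^\gamma)\bigr)=K+\mathbb E D_f\bigl(\boldsymbol b,\boldsymbol A(\boldsymbol x^\gamma)\bigr)+\sigma^2\,\mathbb E\left[\sum_{i=1}^m\frac{\partial g_i}{\partial b_i}(\boldsymbol b)\right],$$ where $K$ is a constant independent of $\gamma$.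
   Context: For a differentiable function $f:\mathbb R^m\to\mathbb R$ (not necessarily convex), the Bregman divergence is $D_f(\boldsymbol x,\boldsymbol y)=f(\boldsymbol x)-f(\boldsymbol y)-\nabla f(\boldsymbol y)^T(\boldsymbol x-\boldsymbol y)$ for $\boldsymbol x,\boldsymbol y\in\mathbb R^m$. $\boldsymbol b\sim\mathcal N(\boldsymbol\beta,\sigma^2\mathbb I)$ means that $\boldsymbol b=(b_1,\dots,b_m)^T$ is a vector of independent random variables, with $b_i$ normally distributed with mean $\beta_i$ and variance $\sigma^2$; $\mathbb I$ is the identity matrix. The functions $\boldsymbol B_\gamma$ form a family indexed by a parameter $\gamma$ (a regularization method with regularization parameter $\gamma$). $\mathbb E$ is expectation over the random vector $\boldsymbol b$, on which $\boldsymbol x^\gamma$ depends; $\mathbb E_{b_i}$ is expectation over the component $b_i$.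
   Formalization: Added assumptions, since the stated ones can leave the identity's expectations undefined: the sum of the ∂g_i/∂b_i(b) is integrable, and the expectation of D_f(A(x* ),A(x^γ)) is well defined (not ∞−∞); its finiteness is then proved. *)

theory Defs
  imports "HOL-Probability.Probability"
begin

definition gradient :: "('a::real_inner \<Rightarrow> real) \<Rightarrow> 'a \<Rightarrow> 'a" where
  "gradient f y = (THE D. GDERIV f y :> D)"

definition bregman :: "('a::real_inner \<Rightarrow> real) \<Rightarrow> 'a \<Rightarrow> 'a \<Rightarrow> real" where
  "bregman f x y = f x - f y - gradient f y \<bullet> (x - y)"

definition partial_deriv :: "'m \<Rightarrow> (real^'m::finite \<Rightarrow> real) \<Rightarrow> real^'m \<Rightarrow> real" where
  "partial_deriv j f x = frechet_derivative f (at x) (axis j 1)"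

primrec cont_diff :: "nat \<Rightarrow> (real^'m::finite \<Rightarrow> real) \<Rightarrow> bool" where
  "cont_diff 0 f \<longleftrightarrow> continuous_on UNIV f"
| "cont_diff (Suc k) f \<longleftrightarrow>
     (\<forall>x. f differentiable (at x)) \<and> (\<forall>j. cont_diff k (partial_deriv j f))"

definition test_function :: "(real^'m::finite \<Rightarrow> real) \<Rightarrow> bool" where
  "test_function \<psi> \<longleftrightarrow> (\<forall>k. cont_diff k \<psi>) \<and> compact (closure {x. \<psi> x \<noteq> 0})"

(* Integrability over lborel on every compact set makes the function Borel measurable, so weak
   derivatives are always represented by Borel functions and can be composed with random vectors. *)
definition locally_integrable :: "(real^'m::finite \<Rightarrow> real) \<Rightarrow> bool" where
  "locally_integrable u \<longleftrightarrow> (\<forall>C. compact C \<longrightarrow> set_integrable lborel C u)"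

(* v is a version of the weak partial derivative of u in direction j; it is determined by u only
   up to Lebesgue null sets. *)
definition has_weak_partial ::
    "(real^'m::finite \<Rightarrow> real) \<Rightarrow> 'm \<Rightarrow> (real^'m \<Rightarrow> real) \<Rightarrow> bool" where
  "has_weak_partial u j v \<longleftrightarrow> locally_integrable u \<and> locally_integrable v \<and>
     (\<forall>\<psi>. test_function \<psi> \<longrightarrow>
        (\<integral>x. u x * partial_deriv j \<psi> x \<partial>lborel) = - (\<integral>x. v x * \<psi> x \<partial>lborel))"

definition weakly_differentiable :: "(real^'m::finite \<Rightarrow> real^'k::finite) \<Rightarrow> bool" where
  "weakly_differentiable g \<longleftrightarrow> (\<forall>i j. \<exists>v. has_weak_partial (\<lambda>y. g y $ i) j v)"

(* b is distributed as N(\<beta>, \<sigma>^2 I); normal_density takes the standard deviation as its parameter. *)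
definition isotropic_normal ::
    "'w measure \<Rightarrow> ('w \<Rightarrow> real^'m::finite) \<Rightarrow> real^'m \<Rightarrow> real \<Rightarrow> bool" where
  "isotropic_normal M b \<beta> \<sigma> \<longleftrightarrow>
     prob_space.indep_vars M (\<lambda>_. borel) (\<lambda>i \<omega>. b \<omega> $ i) UNIV \<and>
     (\<forall>i. distributed M lborel (\<lambda>\<omega>. b \<omega> $ i) (\<lambda>t. ennreal (normal_density (\<beta> $ i) \<sigma> t)))"

(* The expectation of X is a well-defined element of [-\<infinity>, \<infinity>], i.e. not of the form \<infinity> - \<infinity>. *)
definition expectation_defined :: "'w measure \<Rightarrow> ('w \<Rightarrow> real) \<Rightarrow> bool" where
  "expectation_defined M X \<longleftrightarrow> X \<in> borel_measurable M \<and>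
     ((\<integral>\<^sup>+\<omega>. ennreal (X \<omega>) \<partial>M) < \<infinity> \<or> (\<integral>\<^sup>+\<omega>. ennreal (- X \<omega>) \<partial>M) < \<infinity>)"

definition replace_component :: "real^'m::finite \<Rightarrow> 'm \<Rightarrow> real \<Rightarrow> real^'m" where
  "replace_component y i t = (\<chi> k. if k = i then t else y $ k)"

(* The expectation of h(b) over the component b_i alone is finite, the other components being held
   fixed at almost every value of b. *)
definition component_integrable ::
    "'w measure \<Rightarrow> ('w \<Rightarrow> real^'m::finite) \<Rightarrow> 'm \<Rightarrow> (real^'m \<Rightarrow> real) \<Rightarrow> bool" where
  "component_integrable M b i h \<longleftrightarrow>
     (AE \<omega> in M. integrable (distr M borel (\<lambda>\<omega>'. b \<omega>' $ i))
                   (\<lambda>t. \<bar>h (replace_component (b \<omega>) i t)\<bar>))"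

end

theory Submission
  imports Defs
begin

text \<open>
  Subtracting the two divergences leaves $\nabla f(A(x^\gamma)) \cdot (b - \beta)$ with $\beta = A(x^*)$, up
  to $f(\beta) - f(b)$, so with $K = f(\beta) - E f(b)$ everything reduces to Stein's identity
  $E[g(b) \cdot (b - \beta)] = \sigma^2 E[\mathrm{div}\, g(b)]$. To get it, test the weak derivatives against the
  Gaussian density times a smooth radial cutoff centred at $\beta$ and sum over the components. The
  gradient of a radial function is parallel to $x - \beta$, so the error term created by the cutoff is
  again a multiple of $g \cdot (x - \beta)$, with a nonnegative weight if the cutoff decreases. Hence no
  decay of the individual components is needed: Fatou's lemma gives integrability of
  $g(b) \cdot (b - \beta)$ and dominated convergence removes the cutoff.
\<close>

section \<open>The flat function \<open>exp (- (1 / u))\<close> and its derivatives\<close>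

text \<open>
  Polynomials in $1/u$ are allowed as a factor so that the family is closed under differentiation.
\<close>

definition flat_exp :: "real poly \<Rightarrow> real \<Rightarrow> real" where
  "flat_exp p u = (if u > 0 then poly p (1 / u) * exp (- (1 / u)) else 0)"

lemma tendsto_poly_div_exp_0: "((\<lambda>x::real. poly p x * exp (- x)) \<longlongrightarrow> 0) at_top"
proof -
  have "((\<lambda>x::real. \<Sum>i\<le>degree p. coeff p i * (x ^ i / exp x)) \<longlongrightarrow> (\<Sum>i\<le>degree p. coeff p i * 0)) at_top"
    by (intro tendsto_intros tendsto_power_div_exp_0)
  then show ?thesis
    by (simp add: poly_altdef sum_distrib_right exp_minus divide_inverse mult.assoc)
qed

lemma flat_exp_tendsto_0: "((\<lambda>u. flat_exp p u) \<longlongrightarrow> 0) (at_right 0)"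
proof -
  have "((\<lambda>u. poly p (inverse u) * exp (- inverse u)) \<longlongrightarrow> 0) (at_right 0)"
    by (rule filterlim_compose[OF tendsto_poly_div_exp_0 filterlim_inverse_at_top_right])
  moreover have "\<forall>\<^sub>F u in at_right 0. poly p (inverse u) * exp (- inverse u) = flat_exp p u"
    using eventually_at_right_less[of "0::real"]
    by eventually_elim (simp add: flat_exp_def inverse_eq_divide)
  ultimately show ?thesis by (rule Lim_transform_eventually)
qed

text \<open>For \<open>u > 0\<close> the product and chain rules give \<open>1 / u^2\<close> times
  \<open>p - pderiv p\<close> at \<open>1 / u\<close>, again a polynomial in \<open>1 / u\<close>.
  Both open half-lines are handled by locality, so only the gluing point 0 calls for a limit of
  difference quotients.\<close>

lemma flat_exp_DERIV:
  "(flat_exp p has_real_derivative flat_exp (monom 1 2 * (p - pderiv p)) u) (at u)"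
proof -
  consider "u > 0" | "u < 0" | "u = 0" by linarith
  then show ?thesis
  proof cases
    case 1
    have "((\<lambda>u. poly p (1 / u) * exp (- (1 / u))) has_real_derivative
        flat_exp (monom 1 2 * (p - pderiv p)) u) (at u)"
      using 1 by (auto intro!: derivative_eq_intros DERIV_chain'[OF _ poly_DERIV]
          simp: flat_exp_def poly_monom power2_eq_square field_simps)
    then show ?thesis
      by (rule has_field_derivative_transform_within_open[where S="{0<..}"])
        (use 1 in \<open>auto simp: flat_exp_def\<close>)
  next
    case 2
    have "((\<lambda>u. 0) has_real_derivative flat_exp (monom 1 2 * (p - pderiv p)) u) (at u)"
      using 2 by (simp add: flat_exp_def)
    then show ?thesis
      by (rule has_field_derivative_transform_within_open[where S="{..<0}"])
        (use 2 in \<open>auto simp: flat_exp_def\<close>)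
  next
    case 3
    have "((\<lambda>h. (flat_exp p (0 + h) - flat_exp p 0) / h) \<longlongrightarrow> 0) (at 0)"
    proof (subst filterlim_at_split, intro conjI)
      show "((\<lambda>h. (flat_exp p (0 + h) - flat_exp p 0) / h) \<longlongrightarrow> 0) (at_left 0)"
        by (rule tendsto_eventually)
          (use eventually_at_left_real[of "-1" "0::real"] in \<open>auto elim!: eventually_mono simp: flat_exp_def\<close>)
      \<comment> \<open>Dividing by h multiplies the polynomial in \<open>1 / h\<close> by its
        variable, which is what \<open>pCons 0 p\<close> does. The right difference quotient is thus
        itself a flat function and tends to 0.\<close>
      have "\<forall>\<^sub>F h in at_right 0. flat_exp (pCons 0 p) h = (flat_exp p (0 + h) - flat_exp p 0) / h"
        using eventually_at_right_less[of "0::real"]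
        by eventually_elim (simp add: flat_exp_def)
      then show "((\<lambda>h. (flat_exp p (0 + h) - flat_exp p 0) / h) \<longlongrightarrow> 0) (at_right 0)"
        by (rule Lim_transform_eventually[OF flat_exp_tendsto_0])
    qed
    then show ?thesis using 3 by (simp add: DERIV_def flat_exp_def)
  qed
qed

section \<open>Closure properties of \<open>cont_diff\<close>\<close>

lemma partial_derivI:
  "(f has_derivative f') (at x) \<Longrightarrow> partial_deriv j f x = f' (axis j 1)"
  by (simp add: partial_deriv_def frechet_derivative_at[symmetric])

text \<open>Lowering the order serves the Leibniz rule, where each factor also occurs
  undifferentiated next to a partial derivative of the other.\<close>

lemma cont_diff_Suc_imp: "cont_diff (Suc k) u \<Longrightarrow> cont_diff k u"
proof (induction k arbitrary: u)
  case 0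
  then show ?case
    by (auto intro!: differentiable_imp_continuous_on simp: differentiable_on_def
        intro: differentiable_at_withinI)
next
  case (Suc k)
  then show ?case by (metis cont_diff.simps(2))
qed

lemma cont_diff_const: "cont_diff k (\<lambda>x. c)"
proof (induction k arbitrary: c)
  case (Suc k)
  have "partial_deriv j (\<lambda>x. c) = (\<lambda>x. 0)" for j :: 'a
    by (rule ext, rule partial_derivI[OF has_derivative_const])
  with Suc show ?case by simp
qed simp

lemma cont_diff_add:
  "cont_diff k u \<Longrightarrow> cont_diff k v \<Longrightarrow> cont_diff k (\<lambda>x. u x + v x)"
proof (induction k arbitrary: u v)
  case (Suc k)
  have "partial_deriv j (\<lambda>x. u x + v x) = (\<lambda>x. partial_deriv j u x + partial_deriv j v x)" for j
  proof
    fix x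
    have "(u has_derivative frechet_derivative u (at x)) (at x)"
      "(v has_derivative frechet_derivative v (at x)) (at x)"
      using Suc.prems by (simp_all add: frechet_derivative_works[symmetric])
    from has_derivative_add[OF this]
    show "partial_deriv j (\<lambda>x. u x + v x) x = partial_deriv j u x + partial_deriv j v x"
      by (simp add: partial_derivI) (simp add: partial_deriv_def)
  qed
  with Suc show ?case by (auto intro: differentiable_add)
qed (auto intro: continuous_intros)

lemma cont_diff_mult:
  "cont_diff k u \<Longrightarrow> cont_diff k v \<Longrightarrow> cont_diff k (\<lambda>x. u x * v x)"
proof (induction k arbitrary: u v)
  case (Suc k)
  have "partial_deriv j (\<lambda>x. u x * v x) =
      (\<lambda>x. u x * partial_deriv j v x + partial_deriv j u x * v x)" for j
  proof
    fix x
    have "(u has_derivative frechet_derivative u (at x)) (at x)"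
      "(v has_derivative frechet_derivative v (at x)) (at x)"
      using Suc.prems by (simp_all add: frechet_derivative_works[symmetric])
    from has_derivative_mult[OF this]
    show "partial_deriv j (\<lambda>x. u x * v x) x = u x * partial_deriv j v x + partial_deriv j u x * v x"
      by (simp add: partial_derivI) (simp add: partial_deriv_def)
  qed
  moreover have "cont_diff k (\<lambda>x. u x * partial_deriv j v x + partial_deriv j u x * v x)" for j
    using Suc.prems cont_diff_Suc_imp[OF Suc.prems(1)] cont_diff_Suc_imp[OF Suc.prems(2)]
    by (intro cont_diff_add Suc.IH) auto
  ultimately show ?case using Suc.prems by auto
qed (auto intro: continuous_intros)

text \<open>All derivatives of the outer function are supplied at once as a sequence. With n
  arbitrary in the induction, the factor \<open>\<phi> (Suc n) (q x)\<close> from the chain rule is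
  covered by the induction hypothesis.\<close>

lemma cont_diff_compose:
  assumes "\<And>n t. (\<phi> n has_real_derivative \<phi> (Suc n) t) (at t)" and "\<And>k. cont_diff k q"
  shows "cont_diff k (\<lambda>x. \<phi> n (q x))"
proof (induction k arbitrary: n)
  case 0
  have "continuous_on UNIV (\<phi> n)"
    using DERIV_isCont[OF assms(1)] by (simp add: continuous_on_eq_continuous_at)
  then show ?case
    using assms(2)[of 0] by (auto intro: continuous_on_compose2)
next
  case (Suc k)
  have q: "(q has_derivative frechet_derivative q (at x)) (at x)" for x
    using assms(2)[of 1] by (simp add: frechet_derivative_works[symmetric])
  have d: "((\<lambda>x. \<phi> n (q x)) has_derivative
      (\<lambda>h. \<phi> (Suc n) (q x) * frechet_derivative q (at x) h)) (at x)" for x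
    using has_derivative_compose[OF q assms(1)[unfolded has_field_derivative_def]]
    by simp
  have "partial_deriv j (\<lambda>x. \<phi> n (q x)) = (\<lambda>x. \<phi> (Suc n) (q x) * partial_deriv j q x)" for j
    by (rule ext) (simp add: partial_derivI[OF d], simp add: partial_deriv_def)
  moreover have "cont_diff k (\<lambda>x. \<phi> (Suc n) (q x) * partial_deriv j q x)" for j
    using assms(2)[of "Suc k"] by (intro cont_diff_mult Suc.IH) auto
  ultimately show ?case using d by (auto simp: differentiable_def)
qed

lemma has_derivative_norm_diff_sqr:
  "((\<lambda>x. (norm (x - c))\<^sup>2) has_derivative (\<lambda>h. 2 * ((x - c) \<bullet> h))) (at x)"
  unfolding power2_norm_eq_inner
  by (auto intro!: derivative_eq_intros simp: inner_commute)

lemma partial_deriv_norm_diff_sqr: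
  "partial_deriv j (\<lambda>x. (norm (x - c))\<^sup>2) x = 2 * (x $ j - c $ j)"
  by (simp add: partial_derivI[OF has_derivative_norm_diff_sqr] inner_axis)

lemma cont_diff_affine_component: "cont_diff k (\<lambda>x. a * (x $ j - c))"
proof (cases k)
  case (Suc l)
  have d: "((\<lambda>x. a * (x $ j - c)) has_derivative (\<lambda>h. a * h $ j)) (at x)" for x :: "real^'a"
    by (auto intro!: derivative_eq_intros bounded_linear_imp_has_derivative)
  have "partial_deriv i (\<lambda>x. a * (x $ j - c)) = (\<lambda>x. a * axis i 1 $ j)" for i
    by (rule ext) (rule partial_derivI[OF d])
  then show ?thesis using d cont_diff_const Suc by (auto simp: differentiable_def)
qed (simp, intro continuous_intros)

lemma cont_diff_norm_diff_sqr: "cont_diff k (\<lambda>x. (norm (x - c))\<^sup>2)"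
proof (cases k)
  case (Suc l)
  have "partial_deriv j (\<lambda>x. (norm (x - c))\<^sup>2) = (\<lambda>x. 2 * (x $ j - c $ j))" for j
    by (rule ext) (rule partial_deriv_norm_diff_sqr)
  then show ?thesis
    using has_derivative_norm_diff_sqr cont_diff_affine_component[of l 2] Suc
    by (auto simp: differentiable_def)
qed (simp, intro continuous_intros)

section \<open>Test functions paired with locally integrable functions\<close>

lemma test_function_partial_deriv:
  assumes "test_function \<psi>"
  shows "test_function (partial_deriv j \<psi>)"
proof -
  \<comment> \<open>The complement of the support is open and \<open>\<psi>\<close> vanishes on it,
    so the derivative is 0 there and differentiation cannot enlarge the support.\<close>
  have "partial_deriv j \<psi> x = 0" if "x \<notin> closure {x. \<psi> x \<noteq> 0}" for x
  proof -
    have "(\<psi> has_derivative (\<lambda>h. 0)) (at x)"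
      using that closure_subset[of "{x. \<psi> x \<noteq> 0}"]
      by (intro has_derivative_transform_within_open[OF has_derivative_const[of 0],
            where s="- closure {x. \<psi> x \<noteq> 0}"]) auto
    then show ?thesis by (simp add: partial_derivI)
  qed
  then have "{x. partial_deriv j \<psi> x \<noteq> 0} \<subseteq> closure {x. \<psi> x \<noteq> 0}"
    by auto
  then have "compact (closure {x. partial_deriv j \<psi> x \<noteq> 0})"
    using assms unfolding test_function_def
    by (meson closure_minimal closed_closure compact_closure bounded_subset compact_imp_bounded)
  moreover have "cont_diff k (partial_deriv j \<psi>)" for k
    using assms cont_diff.simps(2)[of k \<psi>] unfolding test_function_def by blast
  ultimately show ?thesis by (simp add: test_function_def)
qed

text \<open>The truncations to the balls of radius n are integrable, hence measurable, and at each
  point they are eventually equal to u.\<close>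

lemma locally_integrable_borel_measurable:
  assumes "locally_integrable u"
  shows "u \<in> borel_measurable borel"
proof (rule borel_measurable_LIMSEQ_real)
  show "(\<lambda>n. indicator (cball 0 (real n)) x * u x) \<longlonglongrightarrow> u x" for x
  proof (rule tendsto_eventually)
    have "\<forall>\<^sub>F n in sequentially. norm x \<le> real n"
      using real_arch_simple[of "norm x"] by (meson eventually_sequentiallyI of_nat_le_iff order_trans)
    then show "\<forall>\<^sub>F n in sequentially. indicator (cball 0 (real n)) x * u x = u x"
      by eventually_elim (simp add: indicator_def)
  qed
  show "(\<lambda>x. indicator (cball 0 (real n)) x * u x) \<in> borel_measurable borel" for n
    using assms[unfolded locally_integrable_def set_integrable_def, rule_format,
        OF compact_cball[of 0 "real n"]]
    by (auto dest: borel_measurable_integrable)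
qed

lemma test_function_continuous: "test_function \<psi> \<Longrightarrow> continuous_on UNIV \<psi>"
  unfolding test_function_def by (metis cont_diff.simps(1))

text \<open>A test function is bounded on its compact support, so a multiple of u cut off to that
  support dominates the product.\<close>

lemma locally_integrable_mult_test_function:
  assumes u: "locally_integrable u" and \<psi>: "test_function \<psi>"
  shows "integrable lborel (\<lambda>x. u x * \<psi> x)"
proof -
  let ?C = "closure {x. \<psi> x \<noteq> 0}"
  have C: "compact ?C" using \<psi> by (simp add: test_function_def)
  have cont: "continuous_on UNIV \<psi>" by (rule test_function_continuous[OF \<psi>])
  have "bounded (\<psi> ` ?C)"
    using C cont by (intro compact_imp_bounded compact_continuous_image) (auto intro: continuous_on_subset)
  then obtain K where K: "\<And>x. x \<in> ?C \<Longrightarrow> \<bar>\<psi> x\<bar> \<le> K"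
    unfolding bounded_iff by auto
  have "integrable lborel (\<lambda>x. K * (indicator ?C x *\<^sub>R u x))"
    using u C unfolding locally_integrable_def set_integrable_def by auto
  then show ?thesis
  proof (rule Bochner_Integration.integrable_bound)
    show "(\<lambda>x. u x * \<psi> x) \<in> borel_measurable lborel"
      using locally_integrable_borel_measurable[OF u] borel_measurable_continuous_onI[OF cont]
      by simp
    have "norm (u x * \<psi> x) \<le> norm (K * (indicator ?C x *\<^sub>R u x))" for x
    proof (cases "x \<in> ?C")
      case True
      have "\<bar>u x\<bar> * \<bar>\<psi> x\<bar> \<le> \<bar>u x\<bar> * \<bar>K\<bar>"
        by (rule mult_left_mono) (use K[OF True] in auto)
      with True show ?thesis by (simp add: abs_mult mult.commute)
    next
      case False
      then have "\<psi> x = 0" using closure_subset[of "{x. \<psi> x \<noteq> 0}"] by auto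
      then show ?thesis by simp
    qed
    then show "AE x in lborel. norm (u x * \<psi> x) \<le> norm (K * (indicator ?C x *\<^sub>R u x))"
      by simp
  qed
qed

text \<open>The hypothesis \<open>r\<close> says that the gradient of \<open>\<psi>\<close> is
  parallel to \<open>x - c\<close>. Summing the defining identities of the weak partials over i
  therefore collapses the left sides into one inner product.\<close>

lemma radial_test_function_divergence:
  fixes g :: "real^'m::finite \<Rightarrow> real^'m"
  assumes h: "\<And>i. has_weak_partial (\<lambda>y. g y $ i) i (h i)"
    and \<psi>: "test_function \<psi>"
    and r: "\<And>j x. partial_deriv j \<psi> x = - (r x * (x $ j - c $ j))"
  shows "integrable lborel (\<lambda>x. r x * (g x \<bullet> (x - c)))"
    and "(\<integral>x. r x * (g x \<bullet> (x - c)) \<partial>lborel) = (\<integral>x. \<psi> x * (\<Sum>i\<in>UNIV. h i x) \<partial>lborel)"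
proof -
  have gi: "integrable lborel (\<lambda>x. g x $ i * partial_deriv i \<psi> x)" for i
    using h \<psi> unfolding has_weak_partial_def
    by (intro locally_integrable_mult_test_function test_function_partial_deriv) auto
  have hi: "integrable lborel (\<lambda>x. h i x * \<psi> x)" for i
    using h \<psi> unfolding has_weak_partial_def by (intro locally_integrable_mult_test_function) auto
  have 1: "r x * (g x \<bullet> (x - c)) = (\<Sum>i\<in>UNIV. - (g x $ i * partial_deriv i \<psi> x))" for x
    by (simp add: r inner_vec_def sum_distrib_left algebra_simps)
  have 2: "\<psi> x * (\<Sum>i\<in>UNIV. h i x) = (\<Sum>i\<in>UNIV. h i x * \<psi> x)" for x
    by (simp add: sum_distrib_left mult.commute)
  have 3: "- (\<integral>x. g x $ i * partial_deriv i \<psi> x \<partial>lborel) = (\<integral>x. h i x * \<psi> x \<partial>lborel)" for i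
    using h[of i] \<psi> unfolding has_weak_partial_def by simp
  show "integrable lborel (\<lambda>x. r x * (g x \<bullet> (x - c)))"
    unfolding 1 using gi by auto
  show "(\<integral>x. r x * (g x \<bullet> (x - c)) \<partial>lborel) = (\<integral>x. \<psi> x * (\<Sum>i\<in>UNIV. h i x) \<partial>lborel)"
    unfolding 1 2 using gi hi 3
    by (subst (1 2) Bochner_Integration.integral_sum) auto
qed

section \<open>The Gaussian times a smooth radial cutoff\<close>

lemma flat_exp_one_le: "0 \<le> flat_exp 1 u" "flat_exp 1 u \<le> 1"
  by (auto simp: flat_exp_def)

lemma flat_exp_sqr_le: "0 \<le> flat_exp (monom 1 2) u" "flat_exp (monom 1 2) u \<le> 2"
proof -
  show "0 \<le> flat_exp (monom 1 2) u" by (simp add: flat_exp_def poly_monom)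
  \<comment> \<open>Here v stands for \<open>1 / u\<close>; the bound 2 comes from the quadratic
    term of \<open>exp v \<ge> 1 + v + v^2 / 2\<close>.\<close>
  have "v\<^sup>2 * exp (- v) \<le> 2" if "v > 0" for v :: real
    using exp_lower_Taylor_quadratic[of v] that by (simp add: exp_minus field_simps)
  from this[of "1 / u"] show "flat_exp (monom 1 2) u \<le> 2"
    by (simp add: flat_exp_def poly_monom)
qed

lemma cont_diff_exp_norm_diff_sqr:
  "cont_diff k (\<lambda>x. exp (a * (norm (x - c))\<^sup>2))"
  using cont_diff_compose[where \<phi>="\<lambda>n t. a ^ n * exp (a * t)" and n=0
      and q="\<lambda>x. (norm (x - c))\<^sup>2" and k=k]
  by (force intro!: derivative_eq_intros cont_diff_norm_diff_sqr)

lemma cont_diff_flat_exp_norm_diff_sqr: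
  "cont_diff k (\<lambda>x. flat_exp p (1 + a * (norm (x - c))\<^sup>2))"
proof -
  \<comment> \<open>\<open>P n\<close> is the polynomial belonging to the n-th derivative of
    \<open>flat_exp p\<close>; the affine substitution \<open>1 + a * t\<close> contributes the
    factor \<open>a ^ n\<close>.\<close>
  define P where "P n = ((\<lambda>p. monom 1 2 * (p - pderiv p)) ^^ n) p" for n
  have "((\<lambda>t. a ^ n * flat_exp (P n) (1 + a * t)) has_real_derivative
      a ^ Suc n * flat_exp (P (Suc n)) (1 + a * t)) (at t)" for n t
    unfolding P_def by (auto intro!: derivative_eq_intros DERIV_chain'[OF _ flat_exp_DERIV])
  from cont_diff_compose[of "\<lambda>n t. a ^ n * flat_exp (P n) (1 + a * t)", OF this
      cont_diff_norm_diff_sqr, of k 0 c]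
  show ?thesis by (simp add: P_def)
qed

text \<open>Using the squared norm keeps the function smooth at the centre. It vanishes outside the
  ball of radius R, when \<open>R > 0\<close>, and its value at the centre is
  \<open>exp (- 1)\<close> rather than 1, so this constant is also the limit as R grows.\<close>

definition cutoff :: "real^'m \<Rightarrow> real \<Rightarrow> real^'m::finite \<Rightarrow> real" where
  "cutoff c R x = flat_exp 1 (1 - (norm (x - c))\<^sup>2 / R\<^sup>2)"

text \<open>
  The gradient of the Gaussian times the cutoff is minus the Gaussian times this weight times $x - c$.
  The polynomial $X^2$ stems from $(e^{-1/u})' = u^{-2} e^{-1/u}$.
\<close>

definition gauss_weight :: "real^'m \<Rightarrow> real \<Rightarrow> real \<Rightarrow> real^'m::finite \<Rightarrow> real" where
  "gauss_weight c \<sigma> R x = cutoff c R x / \<sigma>\<^sup>2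
     + 2 / R\<^sup>2 * flat_exp (monom 1 2) (1 - (norm (x - c))\<^sup>2 / R\<^sup>2)"

text \<open>This is the normal density without its normalising constant, which is restored as a
  separate factor when expectations are computed.\<close>

definition gauss :: "real^'m \<Rightarrow> real \<Rightarrow> real^'m::finite \<Rightarrow> real" where
  "gauss c \<sigma> x = exp (- (norm (x - c))\<^sup>2 / (2 * \<sigma>\<^sup>2))"

lemma test_function_gauss_cutoff:
  assumes "R > 0"
  shows "test_function (\<lambda>x. gauss c \<sigma> x * cutoff c R x)"
proof -
  have "{x. gauss c \<sigma> x * cutoff c R x \<noteq> 0} \<subseteq> cball c R"
  proof clarsimp
    fix x assume "cutoff c R x \<noteq> 0"
    then have "(norm (x - c))\<^sup>2 < R\<^sup>2"
      using assms by (auto simp: cutoff_def flat_exp_def field_simps split: if_splits)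
    then have "norm (x - c) < R" using assms power2_less_imp_less by fastforce
    then show "dist c x \<le> R" by (simp add: dist_norm norm_minus_commute)
  qed
  then have "bounded {x. gauss c \<sigma> x * cutoff c R x \<noteq> 0}"
    by (rule bounded_subset[OF bounded_cball])
  moreover have "cont_diff k (\<lambda>x. gauss c \<sigma> x * cutoff c R x)" for k
    using cont_diff_mult[OF cont_diff_exp_norm_diff_sqr[of k "- 1 / (2 * \<sigma>\<^sup>2)" c]
        cont_diff_flat_exp_norm_diff_sqr[of k 1 "- 1 / R\<^sup>2" c]]
    by (simp add: gauss_def cutoff_def)
  ultimately show ?thesis by (simp add: test_function_def compact_closure)
qed

lemma partial_deriv_gauss_cutoff:
  "partial_deriv j (\<lambda>x. gauss c \<sigma> x * cutoff c R x) x =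
     - (gauss c \<sigma> x * gauss_weight c \<sigma> R x * (x $ j - c $ j))"
proof -
  define s where "s = (norm (x - c))\<^sup>2"
  define E where "E = exp (- s / (2 * \<sigma>\<^sup>2))"
  define F where "F = flat_exp 1 (1 - s / R\<^sup>2)"
  define G where "G = flat_exp (monom 1 2) (1 - s / R\<^sup>2)"
  define \<phi> where "\<phi> t = exp (- t / (2 * \<sigma>\<^sup>2)) * flat_exp 1 (1 - t / R\<^sup>2)" for t
  \<comment> \<open>\<open>D\<close> is the derivative at s of the one-variable profile
    \<open>\<phi>\<close>. The gradient of the squared norm is \<open>2 * (x - c)\<close>, and its
    factor 2 turns the coefficients in \<open>D\<close> into those of
    \<open>gauss_weight\<close>.\<close>
  define D where "D = - E * (F / (2 * \<sigma>\<^sup>2) + G / R\<^sup>2)"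
  have D2: "D * 2 = - (E * (F / \<sigma>\<^sup>2 + 2 / R\<^sup>2 * G))"
    by (simp add: D_def algebra_simps)
  have "((\<lambda>t. exp (- t / (2 * \<sigma>\<^sup>2))) has_real_derivative E * (- 1 / (2 * \<sigma>\<^sup>2))) (at s)"
    unfolding E_def by (rule DERIV_fun_exp[OF DERIV_cdivide[OF DERIV_minus[OF DERIV_ident]]])
  moreover have "((\<lambda>t. 1 - t / R\<^sup>2) has_real_derivative (0 - 1 / R\<^sup>2)) (at s)"
    by (rule DERIV_diff[OF DERIV_const DERIV_cdivide[OF DERIV_ident]])
  from DERIV_chain'[OF this flat_exp_DERIV[of 1]]
  have "((\<lambda>t. flat_exp 1 (1 - t / R\<^sup>2)) has_real_derivative - G / R\<^sup>2) (at s)"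
    by (simp add: G_def)
  ultimately have "(\<phi> has_real_derivative E * (- 1 / (2 * \<sigma>\<^sup>2)) * F + - G / R\<^sup>2 * E) (at s)"
    unfolding \<phi>_def[abs_def] E_def F_def by (rule DERIV_mult)
  also have "E * (- 1 / (2 * \<sigma>\<^sup>2)) * F + - G / R\<^sup>2 * E = D"
    by (simp add: D_def algebra_simps)
  finally have "((\<lambda>x. \<phi> ((norm (x - c))\<^sup>2)) has_derivative (\<lambda>h. D * (2 * ((x - c) \<bullet> h)))) (at x)"
    unfolding has_field_derivative_def s_def
    by (rule has_derivative_compose[OF has_derivative_norm_diff_sqr])
  from partial_derivI[OF this]
  have "partial_deriv j (\<lambda>x. \<phi> ((norm (x - c))\<^sup>2)) x = D * (2 * (x $ j - c $ j))"
    by (simp add: inner_axis)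
  also have "D * (2 * (x $ j - c $ j)) = - (E * (F / \<sigma>\<^sup>2 + 2 / R\<^sup>2 * G) * (x $ j - c $ j))"
    using D2 by (simp only: mult.assoc[symmetric] mult_minus_left)
  also have "(\<lambda>x. \<phi> ((norm (x - c))\<^sup>2)) = (\<lambda>x. gauss c \<sigma> x * cutoff c R x)"
    by (simp add: \<phi>_def gauss_def cutoff_def)
  finally show ?thesis
    by (simp only: gauss_weight_def gauss_def[of _ _ x] cutoff_def[of _ _ x] E_def F_def G_def s_def)
qed

section \<open>The joint density of an isotropic normal vector\<close>

lemma Basis_vec_eq_range_axis: "(Basis :: (real^'m::finite) set) = range (\<lambda>i. axis i 1)"
  by (auto simp: Basis_vec_def)

lemma prod_Basis_vec: "(\<Prod>e\<in>Basis. F e) = (\<Prod>i\<in>UNIV. F (axis i 1 :: real^'m::finite))"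
  unfolding Basis_vec_eq_range_axis
  by (subst prod.reindex) (auto simp: inj_on_def axis_eq_axis)

lemma prod_normal_density_eq_gauss:
  "(\<Prod>i\<in>UNIV. normal_density (\<beta> $ i) \<sigma> (x $ i)) =
     (1 / sqrt (2 * pi * \<sigma>\<^sup>2)) ^ CARD('m) * gauss \<beta> \<sigma> (x :: real^'m::finite)"
proof -
  have "(\<Prod>i\<in>UNIV. exp (- (x $ i - \<beta> $ i)\<^sup>2 / (2 * \<sigma>\<^sup>2))) = gauss \<beta> \<sigma> x"
    unfolding gauss_def power2_norm_eq_inner inner_vec_def
    by (simp add: exp_sum[symmetric] sum_negf sum_divide_distrib power2_eq_square)
  then show ?thesis
    by (simp add: normal_density_def prod_dividef power_divide)
qed

lemma (in prob_space) isotropic_normal_random_variable: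
  assumes "isotropic_normal M b \<beta> \<sigma>"
  shows "b \<in> borel_measurable M"
proof -
  have "(\<lambda>\<omega>. b \<omega> $ i) \<in> borel_measurable M" for i
    using assms by (auto simp: isotropic_normal_def distributed_def)
  then show ?thesis
    by (subst borel_measurable_euclidean_space) (auto simp: Basis_vec_def inner_axis)
qed

text \<open>Open boxes are stable under intersection and generate the Borel sets, so it suffices to
  compare the law of b with the density on boxes. The indicator of a box is a product over
  coordinates, and independence factors its expectation into the given marginals.\<close>

lemma (in prob_space) isotropic_normal_distributed:
  fixes b :: "'a \<Rightarrow> real^'m::finite"
  assumes b: "isotropic_normal M b \<beta> \<sigma>"
  shows "distributed M lborel b
    (\<lambda>x. ennreal ((1 / sqrt (2 * pi * \<sigma>\<^sup>2)) ^ CARD('m) * gauss \<beta> \<sigma> x))"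
proof -
  let ?n = "\<lambda>i t. normal_density (\<beta> $ i) \<sigma> t"
  let ?d = "\<lambda>x::real^'m. ennreal (\<Prod>i\<in>UNIV. ?n i (x $ i))"
  have [measurable]: "b \<in> borel_measurable M"
    by (rule isotropic_normal_random_variable[OF b])
  have indep: "indep_vars (\<lambda>_. borel) (\<lambda>i \<omega>. b \<omega> $ i) UNIV"
    and D: "\<And>i. distributed M lborel (\<lambda>\<omega>. b \<omega> $ i) (\<lambda>t. ennreal (?n i t))"
    using b by (auto simp: isotropic_normal_def)
  have d[measurable]: "?d \<in> borel_measurable borel" by measurable
  have "distr M borel b = density lborel ?d"
  proof (rule measure_eqI_generator_eq)
    let ?E = "range (\<lambda>(a, b). box a b::(real^'m) set)"
    show "Int_stable ?E"
      by (auto simp: Int_stable_def box_Int_box)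
    show "?E \<subseteq> Pow UNIV" "sets (distr M borel b) = sigma_sets UNIV ?E"
      "sets (density lborel ?d) = sigma_sets UNIV ?E"
      by (simp_all add: borel_eq_box)
    let ?A = "\<lambda>n::nat. box (- (real n *\<^sub>R One)) (real n *\<^sub>R One) :: (real^'m) set"
    show "range ?A \<subseteq> ?E" "(\<Union>i. ?A i) = UNIV"
      unfolding UN_box_eq_UNIV by auto
    interpret D: prob_space "distr M borel b" by (rule prob_space_distr) simp
    show "emeasure (distr M borel b) (?A i) \<noteq> \<infinity>" for i by simp
    fix X assume "X \<in> ?E"
    then obtain l u where X: "X = box l u" by auto
    let ?I = "\<lambda>i t. indicator {l $ i <..< u $ i} t :: ennreal"
    have X_eq: "indicator X x = (\<Prod>i\<in>UNIV. ?I i (x $ i))" for x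
    proof (cases "\<forall>i. l $ i < x $ i \<and> x $ i < u $ i")
      case True then show ?thesis by (simp add: X mem_box_cart)
    next
      case False
      then have "\<exists>i\<in>UNIV. ?I i (x $ i) = 0" by (auto simp: indicator_def)
      then have "(\<Prod>i\<in>UNIV. ?I i (x $ i)) = 0" by (intro prod_zero) auto
      with False show ?thesis by (simp add: X mem_box_cart)
    qed
    have "emeasure (distr M borel b) X = (\<integral>\<^sup>+x. indicator X x \<partial>distr M borel b)"
      by (simp add: X)
    also have "\<dots> = (\<integral>\<^sup>+\<omega>. indicator X (b \<omega>) \<partial>M)"
      by (rule nn_integral_distr) (simp_all add: X)
    also have "\<dots> = (\<integral>\<^sup>+\<omega>. (\<Prod>i\<in>UNIV. ?I i (b \<omega> $ i)) \<partial>M)"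
      by (simp add: X_eq)
    also have "\<dots> = (\<Prod>i\<in>UNIV. \<integral>\<^sup>+\<omega>. ?I i (b \<omega> $ i) \<partial>M)"
      by (intro indep_vars_nn_integral indep_vars_compose2[OF indep, of ?I]) auto
    also have "\<dots> = (\<Prod>i\<in>UNIV. \<integral>\<^sup>+t. ennreal (?n i t) * ?I i t \<partial>lborel)"
      by (intro prod.cong refl distributed_nn_integral[OF D, symmetric]) simp
    \<comment> \<open>Indexing by basis vectors instead of coordinates allows
      \<open>nn_integral_lborel_prod\<close> to reassemble the one-dimensional integrals into one
      over the whole space.\<close>
    also have "\<dots> = (\<Prod>e\<in>Basis. \<integral>\<^sup>+t. ennreal (normal_density (\<beta> \<bullet> e) \<sigma> t)
        * indicator {l \<bullet> e <..< u \<bullet> e} t \<partial>lborel)"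
      by (simp add: prod_Basis_vec inner_axis)
    also have "\<dots> = (\<integral>\<^sup>+x. (\<Prod>e\<in>Basis. ennreal (normal_density (\<beta> \<bullet> e) \<sigma> (x \<bullet> e))
        * indicator {l \<bullet> e <..< u \<bullet> e} (x \<bullet> e)) \<partial>lborel)"
      by (rule nn_integral_lborel_prod[symmetric]) auto
    also have "\<dots> = (\<integral>\<^sup>+x. ?d x * indicator X x \<partial>lborel)"
      by (simp add: prod_Basis_vec inner_axis X_eq prod.distrib prod_ennreal)
    also have "\<dots> = emeasure (density lborel ?d) X"
      by (subst emeasure_density) (auto simp: X)
    finally show "emeasure (distr M borel b) X = emeasure (density lborel ?d) X" .
  qed
  then have "distributed M lborel b ?d"
    by (simp add: distributed_def cong: distr_cong)
  then show ?thesis by (simp only: prod_normal_density_eq_gauss)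
qed

section \<open>Removing bounded weights from an integral\<close>

text \<open>With the negative part N integrable, the weighted integrals of N converge by domination,
  hence so do those of the positive part P. Fatou then makes P integrable, and domination applied to
  X itself identifies the limit.\<close>

lemma weighted_integral_limit_aux:
  fixes X :: "'a \<Rightarrow> real" and w :: "nat \<Rightarrow> 'a \<Rightarrow> real"
  assumes [measurable]: "X \<in> borel_measurable M"
    and neg: "(\<integral>\<^sup>+x. ennreal (- X x) \<partial>M) < \<infinity>"
    and w_meas[measurable]: "\<And>n. w n \<in> borel_measurable M"
    and w: "\<And>n x. 0 \<le> w n x" "\<And>n x. w n x \<le> C" "\<And>x. (\<lambda>n. w n x) \<longlonglongrightarrow> c"
    and "c > 0"
    and int: "\<And>n. integrable M (\<lambda>x. w n x * X x)"
    and lim: "(\<lambda>n. \<integral>x. w n x * X x \<partial>M) \<longlonglongrightarrow> L"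
  shows "integrable M X" and "c * (\<integral>x. X x \<partial>M) = L"
proof -
  define P where "P x = max 0 (X x)" for x
  define N where "N x = max 0 (- X x)" for x
  have [measurable]: "P \<in> borel_measurable M" "N \<in> borel_measurable M"
    unfolding P_def[abs_def] N_def[abs_def] by measurable
  have X: "X x = P x - N x" for x by (simp add: P_def N_def max_def)
  have "ennreal (N x) = ennreal (- X x)" for x by (simp add: N_def max_def ennreal_neg)
  then have N: "integrable M N"
    using neg by (intro integrableI_nonneg) (auto simp: N_def)
  \<comment> \<open>This is used first for N and, once X is known to be integrable, for X.\<close>
  have dom: "integrable M (\<lambda>x. w n x * Y x)" "(\<lambda>n. \<integral>x. w n x * Y x \<partial>M) \<longlonglongrightarrow> (\<integral>x. c * Y x \<partial>M)"
    if Y: "integrable M Y" for n and Y :: "'a \<Rightarrow> real"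
  proof -
    have [measurable]: "Y \<in> borel_measurable M" using Y by auto
    have CY: "integrable M (\<lambda>x. C * \<bar>Y x\<bar>)" using Y by auto
    have bd: "norm (w n x * Y x) \<le> C * \<bar>Y x\<bar>" for n x
      using w(1,2)[of n x] by (simp add: abs_mult mult_right_mono)
    show "integrable M (\<lambda>x. w n x * Y x)"
      by (rule Bochner_Integration.integrable_bound[OF CY])
        (auto intro!: AE_I2 order_trans[OF bd[unfolded real_norm_def]])
    show "(\<lambda>n. \<integral>x. w n x * Y x \<partial>M) \<longlonglongrightarrow> (\<integral>x. c * Y x \<partial>M)"
      by (rule integral_dominated_convergence[OF _ _ CY])
        (auto intro!: bd[unfolded real_norm_def] tendsto_mult w(3))
  qed
  have wP: "w n x * P x = w n x * X x + w n x * N x" for n x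
    by (simp add: X algebra_simps)
  have intP: "integrable M (\<lambda>x. w n x * P x)" for n
    unfolding wP using int dom(1)[OF N] by auto
  have P_nn: "0 \<le> P x" for x by (simp add: P_def)
  have limP: "(\<lambda>n. \<integral>x. w n x * P x \<partial>M) \<longlonglongrightarrow> L + (\<integral>x. c * N x \<partial>M)"
    unfolding wP using tendsto_add[OF lim dom(2)[OF N]] by (simp add: int dom(1)[OF N])
  \<comment> \<open>Fatou applies because \<open>c * P x\<close> is the pointwise limit of the
    nonnegative \<open>w n x * P x\<close>, whose integrals tend to the finite limit in
    \<open>limP\<close>.\<close>
  have "(\<integral>\<^sup>+x. ennreal (c * P x) \<partial>M) = (\<integral>\<^sup>+x. liminf (\<lambda>n. ennreal (w n x * P x)) \<partial>M)"
    by (intro nn_integral_cong lim_imp_Liminf[symmetric] tendsto_ennrealI tendsto_mult w(3)) auto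
  also have "\<dots> \<le> liminf (\<lambda>n. \<integral>\<^sup>+x. ennreal (w n x * P x) \<partial>M)"
    by (rule nn_integral_liminf) measurable
  also have "\<dots> = liminf (\<lambda>n. ennreal (\<integral>x. w n x * P x \<partial>M))"
    by (subst nn_integral_eq_integral[OF intP]) (auto simp: w(1) P_nn)
  also have "\<dots> = ennreal (L + (\<integral>x. c * N x \<partial>M))"
    by (intro lim_imp_Liminf tendsto_ennrealI limP) auto
  finally have "integrable M (\<lambda>x. c * P x)"
    using \<open>c > 0\<close> by (intro integrableI_nonneg) (auto simp: P_nn intro: le_less_trans)
  then have P: "integrable M P" using \<open>c > 0\<close> by simp
  have "integrable M (\<lambda>x. P x - N x)" by (rule Bochner_Integration.integrable_diff[OF P N])
  then show intX: "integrable M X" by (simp only: X[symmetric])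
  have "(\<integral>x. c * X x \<partial>M) = L" by (rule LIMSEQ_unique[OF dom(2)[OF intX] lim])
  then show "c * (\<integral>x. X x \<partial>M) = L" by simp
qed

text \<open>A defined expectation has a finite positive or negative part. The second case is the
  auxiliary lemma itself; the first follows from it for \<open>- X\<close> and
  \<open>- L\<close>.\<close>

lemma weighted_integral_limit:
  fixes X :: "'a \<Rightarrow> real" and w :: "nat \<Rightarrow> 'a \<Rightarrow> real"
  assumes X: "expectation_defined M X"
    and w: "\<And>n. w n \<in> borel_measurable M"
      "\<And>n x. 0 \<le> w n x" "\<And>n x. w n x \<le> C" "\<And>x. (\<lambda>n. w n x) \<longlonglongrightarrow> c"
    and c: "c > 0"
    and int: "\<And>n. integrable M (\<lambda>x. w n x * X x)"
    and lim: "(\<lambda>n. \<integral>x. w n x * X x \<partial>M) \<longlonglongrightarrow> L"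
  shows "integrable M X \<and> c * (\<integral>x. X x \<partial>M) = L"
proof (cases "(\<integral>\<^sup>+x. ennreal (- X x) \<partial>M) < \<infinity>")
  case True
  have meas: "X \<in> borel_measurable M" using X by (simp add: expectation_defined_def)
  note aux = weighted_integral_limit_aux[of X M w C c L]
  show ?thesis
    by (intro conjI aux meas True w c int lim)
next
  case False
  with X have fin: "(\<integral>\<^sup>+x. ennreal (- (- X x)) \<partial>M) < \<infinity>"
    and meas: "(\<lambda>x. - X x) \<in> borel_measurable M"
    by (simp_all add: expectation_defined_def)
  have int': "integrable M (\<lambda>x. w n x * - X x)" for n using int[of n] by simp
  have lim': "(\<lambda>n. \<integral>x. w n x * - X x \<partial>M) \<longlonglongrightarrow> - L" using tendsto_minus[OF lim] by simp
  note aux = weighted_integral_limit_aux[of "\<lambda>x. - X x" M w C c "- L"]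
  have "integrable M (\<lambda>x. - X x)" "c * (\<integral>x. - X x \<partial>M) = - L"
    by (intro aux meas fin w c int' lim')+
  then show ?thesis by simp
qed

section \<open>Uniform bounds and limits of the weights, and Stein's identity\<close>

lemma gauss_nonneg: "0 \<le> gauss c \<sigma> x" by (simp add: gauss_def)

lemma cutoff_le: "0 \<le> cutoff c R x" "cutoff c R x \<le> 1"
  by (simp_all add: cutoff_def flat_exp_one_le)

lemma cutoff_measurable: "cutoff c R \<in> borel_measurable borel"
  using cont_diff_flat_exp_norm_diff_sqr[of 0 1 "- 1 / R\<^sup>2" c]
  by (intro borel_measurable_continuous_onI) (simp add: cutoff_def[abs_def])

lemma gauss_weight_measurable: "gauss_weight c \<sigma> R \<in> borel_measurable borel"
proof -
  have [measurable]: "(\<lambda>x. flat_exp (monom 1 2) (1 - (norm (x - c))\<^sup>2 / R\<^sup>2)) \<in> borel_measurable borel"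
    using cont_diff_flat_exp_norm_diff_sqr[of 0 "monom 1 2" "- 1 / R\<^sup>2" c]
    by (intro borel_measurable_continuous_onI) simp
  have [measurable]: "cutoff c R \<in> borel_measurable borel" by (rule cutoff_measurable)
  show ?thesis unfolding gauss_weight_def[abs_def] by measurable
qed

text \<open>The bound is uniform in R, as the removal of the cutoff requires: 4 is the product of
  \<open>2 / R^2 \<le> 2\<close> and the bound 2 on the flat factor.\<close>

lemma gauss_weight_le:
  assumes "R \<ge> 1"
  shows "0 \<le> gauss_weight c \<sigma> R x" "gauss_weight c \<sigma> R x \<le> 1 / \<sigma>\<^sup>2 + 4"
proof -
  let ?e = "flat_exp (monom 1 2) (1 - (norm (x - c))\<^sup>2 / R\<^sup>2)"
  show "0 \<le> gauss_weight c \<sigma> R x"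
    unfolding gauss_weight_def by (simp add: cutoff_le flat_exp_sqr_le)
  have "2 / R\<^sup>2 \<le> 2" using assms by (simp add: field_simps)
  then have "2 / R\<^sup>2 * ?e \<le> 2 * 2"
    by (intro mult_mono flat_exp_sqr_le) auto
  moreover have "cutoff c R x / \<sigma>\<^sup>2 \<le> 1 / \<sigma>\<^sup>2"
    by (intro divide_right_mono cutoff_le) simp
  ultimately show "gauss_weight c \<sigma> R x \<le> 1 / \<sigma>\<^sup>2 + 4"
    unfolding gauss_weight_def by linarith
qed

lemma divide_Suc_sqr_tendsto_0: "(\<lambda>n. s / (real (Suc n))\<^sup>2) \<longlonglongrightarrow> 0"
  using tendsto_mult[OF tendsto_const[of s] tendsto_power[OF LIMSEQ_inverse_real_of_nat, of 2]]
  by (simp add: divide_inverse power_inverse)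

lemma flat_exp_radial_tendsto:
  "(\<lambda>n. flat_exp p (1 - s / (real (Suc n))\<^sup>2)) \<longlonglongrightarrow> flat_exp p 1"
proof (rule isCont_tendsto_compose[OF DERIV_isCont[OF flat_exp_DERIV]])
  show "(\<lambda>n. 1 - s / (real (Suc n))\<^sup>2) \<longlonglongrightarrow> 1"
    using tendsto_diff[OF tendsto_const[of 1] divide_Suc_sqr_tendsto_0[of s]] by simp
qed

lemma cutoff_tendsto: "(\<lambda>n. cutoff c (real (Suc n)) x) \<longlonglongrightarrow> exp (- 1)"
  using flat_exp_radial_tendsto[of 1] unfolding cutoff_def by (simp add: flat_exp_def)

text \<open>The term caused by differentiating the cutoff carries \<open>1 / R^2\<close> and dies
  out; only the Gaussian part survives.\<close>

lemma gauss_weight_tendsto: "(\<lambda>n. gauss_weight c \<sigma> (real (Suc n)) x) \<longlonglongrightarrow> exp (- 1) / \<sigma>\<^sup>2"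
proof -
  from tendsto_add[OF tendsto_mult[OF cutoff_tendsto tendsto_const[of "inverse (\<sigma>\<^sup>2)"]]
      tendsto_mult[OF divide_Suc_sqr_tendsto_0[of 2] flat_exp_radial_tendsto]]
  show ?thesis
    unfolding gauss_weight_def by (simp add: divide_inverse)
qed

text \<open>Integrability is assumed of the divergence only; that of the inner product belongs to
  the conclusion and comes from the limit along the weights.\<close>

lemma (in prob_space) stein_identity:
  fixes b :: "'a \<Rightarrow> real^'m::finite"
  assumes "\<sigma> > 0" and b: "isotropic_normal M b \<beta> \<sigma>"
    and h: "\<And>i. has_weak_partial (\<lambda>y. g y $ i) i (h i)"
    and H: "integrable M (\<lambda>\<omega>. \<Sum>i\<in>UNIV. h i (b \<omega>))"
    and X: "expectation_defined M (\<lambda>\<omega>. g (b \<omega>) \<bullet> (b \<omega> - \<beta>))"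
  shows "integrable M (\<lambda>\<omega>. g (b \<omega>) \<bullet> (b \<omega> - \<beta>)) \<and>
    (\<integral>\<omega>. g (b \<omega>) \<bullet> (b \<omega> - \<beta>) \<partial>M) = \<sigma>\<^sup>2 * (\<integral>\<omega>. (\<Sum>i\<in>UNIV. h i (b \<omega>)) \<partial>M)"
proof -
  let ?k = "(1 / sqrt (2 * pi * \<sigma>\<^sup>2)) ^ CARD('m)"
  let ?X = "\<lambda>y. g y \<bullet> (y - \<beta>)" and ?H = "\<lambda>y. \<Sum>i\<in>UNIV. h i y"
  \<comment> \<open>Radii \<open>real (Suc n)\<close> are at least 1, so the cutoff has compact
    support and \<open>gauss_weight_le\<close> applies from n = 0 on.\<close>
  let ?w = "\<lambda>n. gauss_weight \<beta> \<sigma> (real (Suc n))" and ?c = "\<lambda>n. cutoff \<beta> (real (Suc n))"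
  have D: "distributed M lborel b (\<lambda>x. ennreal (?k * gauss \<beta> \<sigma> x))"
    by (rule isotropic_normal_distributed[OF b])
  have nn: "0 \<le> ?k * gauss \<beta> \<sigma> x" for x by (simp add: gauss_nonneg)
  have [measurable]: "b \<in> borel_measurable M" by (rule isotropic_normal_random_variable[OF b])
  have [measurable]: "(\<lambda>y. g y $ i) \<in> borel_measurable borel" "h i \<in> borel_measurable borel" for i
    using h[of i] by (auto simp: has_weak_partial_def locally_integrable_borel_measurable)
  have [measurable]: "(\<lambda>y::real^'m. y $ i) \<in> borel_measurable borel" for i
    by (intro borel_measurable_continuous_onI continuous_intros)
  have [measurable]: "?X \<in> borel_measurable borel" "?H \<in> borel_measurable borel"
    unfolding inner_vec_def vector_minus_component by measurable
  note [measurable] = cutoff_measurable gauss_weight_measurable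
  have wX: "integrable M (\<lambda>\<omega>. ?w n (b \<omega>) * ?X (b \<omega>))"
    and cH: "(\<integral>\<omega>. ?w n (b \<omega>) * ?X (b \<omega>) \<partial>M) = (\<integral>\<omega>. ?c n (b \<omega>) * ?H (b \<omega>) \<partial>M)" for n
  proof -
    have "real (Suc n) > 0" by simp
    \<comment> \<open>The divergence identity holds under Lebesgue measure with the Gaussian inside
      the test function; multiplying by the constant \<open>?k\<close> turns both sides into
      expectations over b.\<close>
    note div = radial_test_function_divergence[where g=g and h=h, OF h
        test_function_gauss_cutoff[OF this, where c=\<beta> and \<sigma>=\<sigma>]
        partial_deriv_gauss_cutoff[where c=\<beta> and \<sigma>=\<sigma> and R="real (Suc n)"]]
    show "integrable M (\<lambda>\<omega>. ?w n (b \<omega>) * ?X (b \<omega>))"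
      using div(1)
      by (subst distributed_integrable[OF D _ nn, symmetric]) (auto simp: mult.assoc)
    have "(\<integral>\<omega>. ?w n (b \<omega>) * ?X (b \<omega>) \<partial>M) =
        ?k * (\<integral>x. gauss \<beta> \<sigma> x * ?w n x * ?X x \<partial>lborel)"
      by (subst distributed_integral[OF D _ nn, symmetric]) (auto simp: mult.assoc)
    also have "\<dots> = ?k * (\<integral>x. gauss \<beta> \<sigma> x * ?c n x * ?H x \<partial>lborel)"
      using div(2) by simp
    also have "\<dots> = (\<integral>\<omega>. ?c n (b \<omega>) * ?H (b \<omega>) \<partial>M)"
      by (subst distributed_integral[OF D _ nn, symmetric]) (auto simp: mult.assoc)
    finally show "(\<integral>\<omega>. ?w n (b \<omega>) * ?X (b \<omega>) \<partial>M) = (\<integral>\<omega>. ?c n (b \<omega>) * ?H (b \<omega>) \<partial>M)" .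
  qed
  have "(\<lambda>n. \<integral>\<omega>. ?c n (b \<omega>) * ?H (b \<omega>) \<partial>M) \<longlonglongrightarrow> (\<integral>\<omega>. exp (- 1) * ?H (b \<omega>) \<partial>M)"
  proof (rule integral_dominated_convergence[where w="\<lambda>\<omega>. \<bar>?H (b \<omega>)\<bar>"])
    show "AE \<omega> in M. norm (?c n (b \<omega>) * ?H (b \<omega>)) \<le> \<bar>?H (b \<omega>)\<bar>" for n
      by (simp add: abs_mult cutoff_le mult_left_le_one_le)
    show "AE \<omega> in M. (\<lambda>n. ?c n (b \<omega>) * ?H (b \<omega>)) \<longlonglongrightarrow> exp (- 1) * ?H (b \<omega>)"
      by (intro AE_I2 tendsto_mult cutoff_tendsto tendsto_const)
  qed (use H in auto)
  then have lim: "(\<lambda>n. \<integral>\<omega>. ?w n (b \<omega>) * ?X (b \<omega>) \<partial>M) \<longlonglongrightarrow> exp (- 1) * (\<integral>\<omega>. ?H (b \<omega>) \<partial>M)"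
    by (simp only: cH) simp
  \<comment> \<open>The weights on the left tend to \<open>exp (- 1) / \<sigma>^2\<close> and the
    cutoffs on the right to \<open>exp (- 1)\<close>; cancelling the common factor leaves
    \<open>\<sigma>^2\<close>.\<close>
  have "integrable M (\<lambda>\<omega>. ?X (b \<omega>)) \<and>
      exp (- 1) / \<sigma>\<^sup>2 * (\<integral>\<omega>. ?X (b \<omega>) \<partial>M) = exp (- 1) * (\<integral>\<omega>. ?H (b \<omega>) \<partial>M)"
    by (rule weighted_integral_limit[OF X, where w="\<lambda>n \<omega>. ?w n (b \<omega>)" and C="1 / \<sigma>\<^sup>2 + 4"])
      (use \<open>\<sigma> > 0\<close> wX lim gauss_weight_tendsto in \<open>auto intro: gauss_weight_le\<close>)
  then show ?thesis using \<open>\<sigma> > 0\<close> by (simp add: field_simps)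
qed

section \<open>The identity for the expected Bregman divergence\<close>

lemma expectation_defined_add_integrable:
  assumes X: "expectation_defined M X" and Y: "integrable M Y"
  shows "expectation_defined M (\<lambda>\<omega>. X \<omega> + Y \<omega>)"
proof -
  have [measurable]: "X \<in> borel_measurable M" "Y \<in> borel_measurable M"
    using X Y by (auto simp: expectation_defined_def)
  have Y_fin: "(\<integral>\<^sup>+\<omega>. ennreal \<bar>Y \<omega>\<bar> \<partial>M) < \<infinity>"
    using Y by (simp add: integrable_iff_bounded)
  \<comment> \<open>The sign s treats both parts at once: 1 gives the positive part and -1 the
    negative part, each growing by at most \<open>\<bar>Y \<omega>\<bar>\<close>.\<close>
  have fin: "(\<integral>\<^sup>+\<omega>. ennreal (s * (X \<omega> + Y \<omega>)) \<partial>M) < \<infinity>"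
    if "(\<integral>\<^sup>+\<omega>. ennreal (s * X \<omega>) \<partial>M) < \<infinity>" "\<bar>s\<bar> = 1" for s
  proof -
    have le: "ennreal (s * (X \<omega> + Y \<omega>)) \<le> ennreal (s * X \<omega>) + ennreal \<bar>Y \<omega>\<bar>" for \<omega>
    proof -
      have "s * (X \<omega> + Y \<omega>) \<le> max 0 (s * X \<omega>) + \<bar>Y \<omega>\<bar>"
        using \<open>\<bar>s\<bar> = 1\<close> by (auto simp: abs_if split: if_splits)
      then have "ennreal (s * (X \<omega> + Y \<omega>)) \<le> ennreal (max 0 (s * X \<omega>) + \<bar>Y \<omega>\<bar>)"
        by (rule ennreal_leI)
      then show ?thesis by (simp add: ennreal_plus max_def ennreal_neg split: if_splits)
    qed
    have "(\<integral>\<^sup>+\<omega>. ennreal (s * (X \<omega> + Y \<omega>)) \<partial>M)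
        \<le> (\<integral>\<^sup>+\<omega>. ennreal (s * X \<omega>) + ennreal \<bar>Y \<omega>\<bar> \<partial>M)"
      by (rule nn_integral_mono) (rule le)
    also have "\<dots> < \<infinity>"
      using that(1) Y_fin by (subst nn_integral_add) auto
    finally show ?thesis .
  qed
  show ?thesis
    using X fin[of 1] fin[of "-1"] by (auto simp: expectation_defined_def)
qed

theorem proposition1:
  fixes M :: "'w measure"
    and b :: "'w \<Rightarrow> real^'m::finite"
    and \<sigma> :: real
    and f :: "real^'m \<Rightarrow> real"
    and A :: "real^'n::finite \<Rightarrow> real^'m"
    and \<Gamma> :: "'p set"
    and B :: "'p \<Rightarrow> real^'m \<Rightarrow> real^'n"
    and xs :: "real^'n"
    and g :: "'p \<Rightarrow> real^'m \<Rightarrow> real^'m"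
    and dg :: "'p \<Rightarrow> 'm \<Rightarrow> real^'m \<Rightarrow> real"
  assumes "prob_space M"
    and "\<sigma> > 0"
    and "isotropic_normal M b (A xs) \<sigma>"
    and "\<And>y. f differentiable (at y)"
    and "\<And>\<gamma>. \<gamma> \<in> \<Gamma> \<Longrightarrow> g \<gamma> = gradient f \<circ> A \<circ> B \<gamma>"
    and "\<And>\<gamma>. \<gamma> \<in> \<Gamma> \<Longrightarrow> weakly_differentiable (g \<gamma>)"
    and "\<And>\<gamma> i. \<gamma> \<in> \<Gamma> \<Longrightarrow> has_weak_partial (\<lambda>y. g \<gamma> y $ i) i (dg \<gamma> i)"
    and "integrable M (\<lambda>\<omega>. f (b \<omega>))"
    and "\<And>\<gamma>. \<gamma> \<in> \<Gamma> \<Longrightarrow> integrable M (\<lambda>\<omega>. bregman f (b \<omega>) (A (B \<gamma> (b \<omega>))))"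
    and "\<And>\<gamma> i. \<gamma> \<in> \<Gamma> \<Longrightarrow> component_integrable M b i (dg \<gamma> i)"
    (* the remaining two expectations in the identity are meaningful *)
    and "\<And>\<gamma>. \<gamma> \<in> \<Gamma> \<Longrightarrow> integrable M (\<lambda>\<omega>. \<Sum>i\<in>UNIV. dg \<gamma> i (b \<omega>))"
    and "\<And>\<gamma>. \<gamma> \<in> \<Gamma> \<Longrightarrow> expectation_defined M (\<lambda>\<omega>. bregman f (A xs) (A (B \<gamma> (b \<omega>))))"
  shows "\<exists>K. \<forall>\<gamma>\<in>\<Gamma>.
           integrable M (\<lambda>\<omega>. bregman f (A xs) (A (B \<gamma> (b \<omega>)))) \<and>
           (\<integral>\<omega>. bregman f (A xs) (A (B \<gamma> (b \<omega>))) \<partial>M)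
             = K + (\<integral>\<omega>. bregman f (b \<omega>) (A (B \<gamma> (b \<omega>))) \<partial>M)
                 + \<sigma>\<^sup>2 * (\<integral>\<omega>. (\<Sum>i\<in>UNIV. dg \<gamma> i (b \<omega>)) \<partial>M)"
proof -
  interpret prob_space M by fact
  let ?\<beta> = "A xs"
  show ?thesis
  \<comment> \<open>The witness K stays schematic until the last \<open>show\<close> fixes it as
    \<open>f ?\<beta> - expectation (\<lambda>\<omega>. f (b \<omega>))\<close>. Being introduced
    before \<open>\<gamma>\<close>, it cannot depend on it.\<close>
  proof (intro exI ballI)
    fix \<gamma> assume \<gamma>: "\<gamma> \<in> \<Gamma>"
    let ?D = "\<lambda>\<omega>. bregman f (b \<omega>) (A (B \<gamma> (b \<omega>)))"
    let ?D' = "\<lambda>\<omega>. bregman f ?\<beta> (A (B \<gamma> (b \<omega>)))"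
    let ?X = "\<lambda>\<omega>. g \<gamma> (b \<omega>) \<bullet> (b \<omega> - ?\<beta>)"
    let ?H = "\<lambda>\<omega>. \<Sum>i\<in>UNIV. dg \<gamma> i (b \<omega>)"
    note f = \<open>integrable M (\<lambda>\<omega>. f (b \<omega>))\<close>
    have D: "integrable M ?D" by (rule assms(9)[OF \<gamma>])
    \<comment> \<open>Both divergences have the base point
      \<open>A (B \<gamma> (b \<omega>))\<close>, so the values of f there cancel and the gradient
      terms, both with \<open>g \<gamma> (b \<omega>)\<close>, combine.\<close>
    have X: "?X \<omega> = ?D' \<omega> + (f (b \<omega>) - f ?\<beta> - ?D \<omega>)" for \<omega>
      by (simp add: bregman_def assms(5)[OF \<gamma>] inner_diff_right)
    have "integrable M (\<lambda>\<omega>. f (b \<omega>) - f ?\<beta> - ?D \<omega>)"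
      using f D by auto
    \<comment> \<open>\<open>?X\<close> differs from \<open>?D'\<close> by an integrable function,
      so it inherits the defined expectation that Stein's identity asks for.\<close>
    from expectation_defined_add_integrable[OF assms(12)[OF \<gamma>] this]
    have "expectation_defined M ?X" by (simp only: X)
    with stein_identity[OF assms(2) assms(3) assms(7)[OF \<gamma>] assms(11)[OF \<gamma>]]
    have intX: "integrable M ?X" and EX: "expectation ?X = \<sigma>\<^sup>2 * expectation ?H" by auto
    have D': "?D' \<omega> = ?D \<omega> - f (b \<omega>) + f ?\<beta> + ?X \<omega>" for \<omega> by (simp add: X)
    have "integrable M ?D'"
      unfolding D' using f D intX by auto
    moreover have "expectation ?D' = expectation ?D - expectation (\<lambda>\<omega>. f (b \<omega>)) + f ?\<beta> + expectation ?X"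
      unfolding D' using f D intX by (simp add: prob_space)
    ultimately show "integrable M ?D' \<and>
        expectation ?D' = (f ?\<beta> - expectation (\<lambda>\<omega>. f (b \<omega>))) + expectation ?D
          + \<sigma>\<^sup>2 * expectation ?H"
      using EX by simp
  qed
qed

end
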